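(* Let $G=GL(n,\mathbb C)$, and let $2\leq k\leq n$. There are local logarithmic Higgs fields with nilpotent residue for which $\operatorname{tr}(\Phi^k)$ has a pole of order exactly $k-1$.
   Context: A local logarithmic Higgs field for $GL(n,\mathbb C)$, near a marked point with centred coordinate $z$, is an expression $\Phi=\left(\frac{N}{z}+A(z)\right)dz$, where $N\in\mathfrak{gl}_n(\mathbb C)$ is the residue and $A(z)$ is an $n\times n$ matrix of holomorphic functions near $z=0$. The residue is nilpotent if $N$ is a nilpotent matrix. $\operatorname{tr}(\Phi^k)$ is the meromorphic $k$-differential $\operatorname{tr}\bigl((N/z+A(z))^k\bigr)\,dz^k$, and the pole order is taken at $z=0$. *)

theory Defs
  imports "HOL-Complex_Analysis.Complex_Analysis" "Jordan_Normal_Form.Matrix"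
begin

definition trace_mat :: "'a :: comm_monoid_add mat \<Rightarrow> 'a" where
  "trace_mat M = (\<Sum>i<dim_row M. M $$ (i, i))"

definition nilpotent_mat :: "nat \<Rightarrow> 'a :: semiring_1 mat \<Rightarrow> bool" where
  "nilpotent_mat n M \<longleftrightarrow> M \<in> carrier_mat n n \<and> (\<exists>m. M ^\<^sub>m m = 0\<^sub>m n n)"

text \<open>A local logarithmic Higgs field \<open>(N / z + A(z)) dz\<close> for \<open>GL(n, \<complex>)\<close>, in the centred coordinate
  \<open>z\<close>, is encoded by its residue \<open>N\<close> and its holomorphic part \<open>A\<close>. The values of \<open>A\<close> outside
  some neighbourhood of \<open>0\<close> are irrelevant.\<close>

record log_higgs_field =
  residue_mat :: "complex mat"
  hol_part :: "complex \<Rightarrow> complex mat"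

definition local_log_higgs_field :: "nat \<Rightarrow> log_higgs_field \<Rightarrow> bool" where
  "local_log_higgs_field n \<Phi> \<longleftrightarrow>
     residue_mat \<Phi> \<in> carrier_mat n n \<and>
     (\<exists>U. open U \<and> 0 \<in> U \<and>
        (\<forall>z\<in>U. hol_part \<Phi> z \<in> carrier_mat n n) \<and>
        (\<forall>i<n. \<forall>j<n. (\<lambda>z. hol_part \<Phi> z $$ (i, j)) holomorphic_on U))"

text \<open>The coefficient of \<open>dz\<close> in \<open>\<Phi>\<close>. Its value at \<open>z = 0\<close>, where \<open>inverse 0 = 0\<close>, is meaningless.\<close>

definition higgs_coeff :: "log_higgs_field \<Rightarrow> complex \<Rightarrow> complex mat" where
  "higgs_coeff \<Phi> z = inverse z \<cdot>\<^sub>m residue_mat \<Phi> + hol_part \<Phi> z"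

text \<open>The coefficient of \<open>dz\<^sup>k\<close> in the meromorphic \<open>k\<close>-differential \<open>tr(\<Phi>\<^sup>k)\<close>.\<close>

definition trace_power_coeff :: "log_higgs_field \<Rightarrow> nat \<Rightarrow> complex \<Rightarrow> complex" where
  "trace_power_coeff \<Phi> k z = trace_mat (higgs_coeff \<Phi> z ^\<^sub>m k)"

text \<open>\<^const>\<open>zorder\<close> is the order of vanishing, so a pole of order \<open>m\<close> has \<^const>\<open>zorder\<close> equal to
  \<open>- m\<close>; the meromorphy and pole conditions make its value meaningful.\<close>

definition has_pole_of_order :: "(complex \<Rightarrow> complex) \<Rightarrow> complex \<Rightarrow> nat \<Rightarrow> bool" where
  "has_pole_of_order f a m \<longleftrightarrow>
     f meromorphic_on {a} \<and> is_pole f a \<and> zorder f a = - int m"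

end

theory Submission
  imports Defs
begin

text \<open>Let \<open>N\<close> be the nilpotent Jordan block of size \<open>k\<close>, padded by zeros to size \<open>n\<close>, and let \<open>A\<close> be
  the constant elementary matrix closing the chain of basis vectors into a cycle of length \<open>k\<close>.
  Then \<open>N / z + A\<close> is a cyclic shift on \<open>k\<close> coordinates with weights \<open>1/z, \<dots>, 1/z, 1\<close>. The \<open>k\<close>-th
  power of a weighted cyclic shift is the product of its weights times the projection onto those
  \<open>k\<close> coordinates (lemma \<open>cyclic_shift_pow_period\<close>). Hence the trace of the \<open>k\<close>-th power is
  \<open>k / z\<^sup>k\<^sup>-\<^sup>1\<close>. The residue \<open>N\<close> is itself a weighted cyclic shift with one weight equal to \<open>0\<close>, so
  the same lemma yields \<open>N\<^sup>k = 0\<close>.\<close>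

text \<open>The weighted cyclic shift on the first \<open>k\<close> of \<open>n\<close> coordinates: row \<open>i < k\<close> has the single entry
  \<open>w i\<close>, in column \<open>i + 1\<close> modulo \<open>k\<close>, and all other rows vanish.\<close>

definition cyclic_shift_mat :: "nat \<Rightarrow> nat \<Rightarrow> (nat \<Rightarrow> 'a :: zero) \<Rightarrow> 'a mat" where
  "cyclic_shift_mat n k w =
     mat n n (\<lambda>(i, j). if i < k \<and> j = Suc i mod k then w i else 0)"

lemma cyclic_shift_mat_carrier [simp]: "cyclic_shift_mat n k w \<in> carrier_mat n n"
  by (simp add: cyclic_shift_mat_def)

lemma dim_cyclic_shift_mat [simp]:
  "dim_row (cyclic_shift_mat n k w) = n" "dim_col (cyclic_shift_mat n k w) = n"
  by (simp_all add: cyclic_shift_mat_def)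

lemma index_cyclic_shift_mat [simp]:
  assumes "i < n" "j < n"
  shows "cyclic_shift_mat n k w $$ (i, j) = (if i < k \<and> j = Suc i mod k then w i else 0)"
  using assms by (simp add: cyclic_shift_mat_def)

lemma smult_add_cyclic_shift_mat:
  fixes c :: "'a :: semiring_0"
  shows "c \<cdot>\<^sub>m cyclic_shift_mat n k v + cyclic_shift_mat n k w =
         cyclic_shift_mat n k (\<lambda>i. c * v i + w i)"
  by (rule eq_matI) auto

lemma index_cyclic_shift_mat_pow:
  fixes w :: "nat \<Rightarrow> 'a :: comm_semiring_1"
  assumes "k \<le> n" "i < n" "j < n"
  shows "(cyclic_shift_mat n k w ^\<^sub>m m) $$ (i, j) =
           (if i < k then if j = (i + m) mod k then \<Prod>t<m. w ((i + t) mod k) else 0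
            else if m = 0 \<and> i = j then 1 else 0)"
  using assms(3)
proof (induction m arbitrary: j)
  case 0
  then show ?case using assms by auto
next
  case (Suc m)
  let ?C = "cyclic_shift_mat n k w"
  let ?l = "(i + m) mod k"
  have entry: "(?C ^\<^sub>m Suc m) $$ (i, j) = (\<Sum>l<n. (?C ^\<^sub>m m) $$ (i, l) * ?C $$ (l, j))"
    using assms(2) Suc.prems
    by (simp add: scalar_prod_def atLeast0LessThan del: index_cyclic_shift_mat)
  show ?case
  proof (cases "i < k")
    case True
    then have l: "?l < k" by simp
    then have l': "?l < n" using assms(1) by (rule less_le_trans)
    have "(?C ^\<^sub>m Suc m) $$ (i, j) =
          (\<Sum>l<n. if l = ?l then (\<Prod>t<m. w ((i + t) mod k)) * ?C $$ (?l, j) else 0)"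
      unfolding entry using Suc.IH True by (intro sum.cong) auto
    also have "\<dots> = (\<Prod>t<m. w ((i + t) mod k)) * ?C $$ (?l, j)"
      using l' by simp
    finally show ?thesis
      using True l l' Suc.prems by (simp add: mod_Suc_eq)
  next
    case False
    have "(?C ^\<^sub>m Suc m) $$ (i, j) = 0"
      unfolding entry using Suc.IH False Suc.prems by (intro sum.neutral) auto
    then show ?thesis using False by simp
  qed
qed

lemma prod_rotate_mod:
  fixes w :: "nat \<Rightarrow> 'a :: comm_monoid_mult"
  assumes "i < k"
  shows "(\<Prod>t<k. w ((i + t) mod k)) = (\<Prod>t<k. w t)"
proof (rule prod.reindex_bij_betw)
  have "inj_on (\<lambda>t. (i + t) mod k) {..<k}"
    using assms by (auto simp: inj_on_def mod_if split: if_splits)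
  moreover have "(\<lambda>t. (i + t) mod k) ` {..<k} \<subseteq> {..<k}"
    using assms by auto
  ultimately show "bij_betw (\<lambda>t. (i + t) mod k) {..<k} {..<k}"
    by (simp add: bij_betw_def endo_inj_surj)
qed

lemma cyclic_shift_pow_period:
  fixes w :: "nat \<Rightarrow> 'a :: comm_semiring_1"
  assumes "k \<le> n" "0 < k"
  shows "cyclic_shift_mat n k w ^\<^sub>m k =
         mat n n (\<lambda>(i, j). if i = j \<and> i < k then \<Prod>t<k. w t else 0)"
  using assms by (intro eq_matI) (auto simp: index_cyclic_shift_mat_pow prod_rotate_mod)

lemma trace_cyclic_shift_pow_period:
  fixes w :: "nat \<Rightarrow> 'a :: comm_semiring_1"
  assumes "k \<le> n" "0 < k"
  shows "trace_mat (cyclic_shift_mat n k w ^\<^sub>m k) = of_nat k * (\<Prod>t<k. w t)"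
proof -
  have "trace_mat (cyclic_shift_mat n k w ^\<^sub>m k) =
        (\<Sum>i<n. if i \<in> {..<k} then \<Prod>t<k. w t else 0)"
    using assms by (simp add: cyclic_shift_pow_period trace_mat_def)
  also have "\<dots> = (\<Sum>i\<in>{..<n} \<inter> {..<k}. \<Prod>t<k. w t)"
    by (rule sum.inter_restrict [symmetric]) simp
  also have "{..<n} \<inter> {..<k} = {..<k}"
    using assms by auto
  finally show ?thesis by simp
qed

lemma has_pole_of_order_inverse_power:
  fixes c :: complex
  assumes "c \<noteq> 0" "0 < m"
  shows "has_pole_of_order (\<lambda>z. c * inverse z ^ m) 0 m"
proof -
  let ?f = "\<lambda>z. c * inverse z ^ m"
  have mero: "?f meromorphic_on {0}"
    by (intro meromorphic_intros)
  have ord: "zorder ?f 0 = - int m"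
    by (rule zorder_eqI [where S = UNIV and g = "\<lambda>_. c"])
       (use assms in \<open>auto simp: power_int_minus power_inverse\<close>)
  have "is_pole (\<lambda>z. c / (z - 0) ^ m) 0"
    by (rule is_pole_basic [where A = UNIV]) (use assms in auto)
  then have "is_pole ?f 0"
    by (simp add: divide_inverse power_inverse)
  with mero ord show ?thesis
    by (simp add: has_pole_of_order_def)
qed

theorem proposition5p6:
  fixes n k :: nat
  assumes "2 \<le> k" and "k \<le> n"
  shows "\<exists>\<Phi>. local_log_higgs_field n \<Phi> \<and>
             nilpotent_mat n (residue_mat \<Phi>) \<and>
             has_pole_of_order (trace_power_coeff \<Phi> k) 0 (k - 1)"
proof -
  define N :: "complex mat" where
    "N = cyclic_shift_mat n k (\<lambda>i. if i < k - 1 then 1 else 0)"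
  define A :: "complex mat" where
    "A = cyclic_shift_mat n k (\<lambda>i. if i < k - 1 then 0 else 1)"
  define \<Phi> where "\<Phi> = \<lparr>residue_mat = N, hol_part = (\<lambda>_. A)\<rparr>"
  have split: "{..<k} = insert (k - 1) {..<k - 1}"
    using assms by auto
  have "local_log_higgs_field n \<Phi>"
    unfolding local_log_higgs_field_def \<Phi>_def N_def A_def
    by (auto intro!: exI [of _ UNIV])
  moreover have "nilpotent_mat n (residue_mat \<Phi>)"
  proof -
    have "N ^\<^sub>m k = 0\<^sub>m n n"
      using assms unfolding N_def
      by (intro eq_matI) (auto simp: cyclic_shift_pow_period split)
    then show ?thesis
      by (auto simp: nilpotent_mat_def \<Phi>_def N_def)
  qed
  moreover have "has_pole_of_order (trace_power_coeff \<Phi> k) 0 (k - 1)"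
  proof -
    have "trace_power_coeff \<Phi> k z = of_nat k * inverse z ^ (k - 1)" for z
    proof -
      have "higgs_coeff \<Phi> z =
            cyclic_shift_mat n k (\<lambda>i. if i < k - 1 then inverse z else 1)"
        by (auto simp: higgs_coeff_def \<Phi>_def N_def A_def smult_add_cyclic_shift_mat
                 intro!: arg_cong [where f = "cyclic_shift_mat n k"])
      then show ?thesis
        using assms by (simp add: trace_power_coeff_def trace_cyclic_shift_pow_period split)
    qed
    then have "trace_power_coeff \<Phi> k = (\<lambda>z. of_nat k * inverse z ^ (k - 1))"
      by blast
    then show ?thesis
      using assms has_pole_of_order_inverse_power [of "of_nat k" "k - 1"] by simp
  qed
  ultimately show ?thesis by blast
qed

end
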